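(* For every finite word $w$ on the positive integers, the orbit $\mathrm{Orb}(w)$ of $w$ under the free quasi-symmetrizing action is exactly the set of words $w'$ with $\mathrm{Std}(w')=\mathrm{Std}(w)$. Consequently, for every permutation $\sigma\in\bigcup_{n\ge 0}\mathfrak{S}_n$ (viewed as a word), $$\mathbf{G}_\sigma=\sum_{w\in\mathrm{Orb}(\sigma)} w .$$ Moreover, an (infinite) formal linear combination of words on positive integers belongs to $\mathbf{FQSym}^*$ if and only if it is invariant under the free quasi-symmetrizing action.
   Context: Words are finite words on the alphabet $\mathbb{N}\setminus\{0\}$. The standardization $\mathrm{Std}(w)$ of $w=w_1\dots w_n$ is the permutation of $[n]$ obtained by scanning $w$ from left to right and replacing the occurrences of the smallest letter by $1,2,\dots,k$, then the occurrences of the second smallest letter by $k+1,k+2,\dots$, and so on. Let $E$ be the set of infinite sequences $a=(a_1,a_2,\dots)$ of nonnegative integers with finitely many nonzero entries such that the subword $a_{j_1}\dots a_{j_k}$ ($j_1<\dots<j_k$) of nonzero entries (the associated permutation) is a permutation of $[k]$. For a word $w=w_1\dots w_n$ with $\tau=\mathrm{Std}(w)^{-1}=\tau_1\dots\tau_n$, define $f(w)\in E$ as the sequence consisting of $w_{\tau_1}-1$ zeros, then $\tau_1$, then for each $i=1,\dots,n-1$: $w_{\tau_{i+1}}-w_{\tau_i}$ zeros if $\tau_i<\tau_{i+1}$, or $w_{\tau_{i+1}}-w_{\tau_i}-1$ zeros if $\tau_i>\tau_{i+1}$, followed by $\tau_{i+1}$; and then infinitely many zeros. The map $f$ is a bijection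 from words onto $E$, and each word is identified with its image under $f$. $\mathfrak{S}_\infty$ is the group generated by the elementary transpositions $s_i=(i,i+1)$, $i\ge1$. The free quasi-symmetrizing action: $s_i$ acts on $a\in E$ by swapping the $i$-th and $(i+1)$-st entries if one of them is zero, and fixing $a$ otherwise; this is transported to words via $f$ and extended linearly to formal linear combinations of words. $\mathbf{FQSym}^*$ is realized as the linear span (over a field $\mathbb{K}$ of characteristic $0$), inside formal sums of words, of the elements $\mathbf{G}_\sigma=\sum_{w:\ \mathrm{Std}(w)=\sigma} w$ for all permutations $\sigma$.
   Formalization: The last claim is proved for formal sums of bounded degree and, for arbitrary formal sums, with FQSym* replaced by its degree completion; as written it fails, since the sum of all words is invariant but is not a finite combination of the G_σ. *)

theory Defs
  imports
    Complex_Main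
    "HOL-Library.Function_Algebras"
    "HOL-Library.Indicator_Function"
    "HOL-Combinatorics.Multiset_Permutations"
    "HOL-Algebra.Generated_Groups"
    "HOL-Algebra.Group_Action"
begin

section \<open>Words and standardization\<close>

definition words :: "nat list set" where
  "words = {w. 0 \<notin> set w}"

definition perm_words :: "nat list set" where
  "perm_words = (\<Union>n. permutations_of_set {1..n})"

text \<open>When the occurrences of a letter \<open>x\<close> are scanned from left to right, the numbers
  \<open>1, \<dots>, k\<close> have been used up, where \<open>k\<close> is the number of letters smaller than \<open>x\<close>; the
  \<open>m\<close>-th occurrence of \<open>x\<close> is therefore replaced by \<open>k + m\<close>.\<close>

definition Std :: "nat list \<Rightarrow> nat list" where
  "Std w = map (\<lambda>i. card {j. j < length w \<and> w ! j < w ! i} + card {j. j \<le> i \<and> w ! j = w ! i})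
             [0..<length w]"

text \<open>The inverse of a permutation of \<open>[n]\<close> in one-line notation: its \<open>v\<close>-th letter is the
  (1-based) position of \<open>v\<close>.\<close>

definition inverse_word :: "nat list \<Rightarrow> nat list" where
  "inverse_word \<sigma> = map (\<lambda>v. Suc (length (takeWhile (\<lambda>u. u \<noteq> v) \<sigma>))) [1..<Suc (length \<sigma>)]"

section \<open>The set \<open>E\<close> and the encoding of words\<close>

text \<open>A sequence \<open>(a\<^sub>1, a\<^sub>2, \<dots>)\<close> is a function on \<^typ>\<open>nat\<close> whose (unused) value at \<open>0\<close> is \<open>0\<close>.\<close>

definition supp :: "(nat \<Rightarrow> nat) \<Rightarrow> nat set" where
  "supp a = {j. a j \<noteq> 0}"

definition assoc_perm :: "(nat \<Rightarrow> nat) \<Rightarrow> nat list" where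
  "assoc_perm a = map a (sorted_list_of_set (supp a))"

definition E :: "(nat \<Rightarrow> nat) set" where
  "E = {a. a 0 = 0 \<and> finite (supp a) \<and> assoc_perm a \<in> perm_words}"

text \<open>The list \<open>encode_list w\<close> is the sequence \<open>f(w)\<close> up to its last nonzero entry. Here
  \<open>t i\<close> is \<open>\<tau>\<^bsub>i+1\<^esub>\<close> and \<open>x i\<close> is the letter of \<open>w\<close> at position \<open>\<tau>\<^bsub>i+1\<^esub>\<close>; none of the subtractions
  truncates, because \<open>x\<close> is weakly increasing, strictly so at the descents of \<open>\<tau>\<close>.\<close>

definition encode_list :: "nat list \<Rightarrow> nat list" where
  "encode_list w =
    (let t = (\<lambda>i. inverse_word (Std w) ! i);
         x = (\<lambda>i. w ! (t i - 1));
         zeros = (\<lambda>i. if i = 0 then x 0 - 1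
                      else if t (i - 1) < t i then x i - x (i - 1)
                      else x i - x (i - 1) - 1)
     in concat (map (\<lambda>i. replicate (zeros i) 0 @ [t i]) [0..<length w]))"

definition encode :: "nat list \<Rightarrow> nat \<Rightarrow> nat" where
  "encode w = (\<lambda>j. if 1 \<le> j \<and> j \<le> length (encode_list w) then encode_list w ! (j - 1) else 0)"

section \<open>The free quasi-symmetrizing action\<close>

abbreviation elem_transp :: "nat \<Rightarrow> nat \<Rightarrow> nat" where
  "elem_transp i \<equiv> transpose i (Suc i)"

definition Sym_pos :: "(nat \<Rightarrow> nat) monoid" where
  "Sym_pos = \<lparr>carrier = {p. p permutes {1..}}, mult = (\<circ>), one = id\<rparr>"

definition S_inf :: "(nat \<Rightarrow> nat) monoid" where
  "S_inf = Sym_pos\<lparr>carrier := generate Sym_pos (elem_transp ` {1..})\<rparr>"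

definition gen_act :: "nat \<Rightarrow> (nat \<Rightarrow> nat) \<Rightarrow> nat \<Rightarrow> nat" where
  "gen_act i a = (if a i = 0 \<or> a (Suc i) = 0 then a(i := a (Suc i), Suc i := a i) else a)"

definition transp_prod :: "nat list \<Rightarrow> nat \<Rightarrow> nat" where
  "transp_prod is = foldr (\<lambda>i p. elem_transp i \<circ> p) is id"

text \<open>A permutation \<open>p = s\<^bsub>i\<^sub>1\<^esub> \<cdots> s\<^bsub>i\<^sub>k\<^esub>\<close> acts as the composition of the actions of
  \<open>s\<^bsub>i\<^sub>1\<^esub>, \<dots>, s\<^bsub>i\<^sub>k\<^esub>\<close>. By \<open>seq_act_eqI\<close> below the result does not depend on the factorization, and
  \<open>group_action_seq_act\<close> and \<open>seq_act_elem_transp\<close> say that this is the action of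
  \<open>S_inf\<close> on \<open>E\<close> extending \<open>gen_act\<close>.\<close>

definition seq_act :: "(nat \<Rightarrow> nat) \<Rightarrow> (nat \<Rightarrow> nat) \<Rightarrow> nat \<Rightarrow> nat" where
  "seq_act p = (\<lambda>a\<in>E. foldr gen_act (SOME is. set is \<subseteq> {1..} \<and> transp_prod is = p) a)"

definition word_act :: "(nat \<Rightarrow> nat) \<Rightarrow> nat list \<Rightarrow> nat list" where
  "word_act p = (\<lambda>w\<in>words. inv_into words encode (seq_act p (encode w)))"

definition Orb :: "nat list \<Rightarrow> nat list set" where
  "Orb w = orbit S_inf word_act w"

subsection \<open>The action on \<open>E\<close> is well defined\<close>

lemma group_Sym_pos: "group Sym_pos"
proof (rule groupI)
  fix p assume p: "p \<in> carrier Sym_pos"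
  then have "inv_into UNIV p permutes {1..}" and "inv_into UNIV p \<circ> p = id"
    by (auto simp: Sym_pos_def permutes_inv permutes_inv_o)
  then show "\<exists>q\<in>carrier Sym_pos. q \<otimes>\<^bsub>Sym_pos\<^esub> p = \<one>\<^bsub>Sym_pos\<^esub>"
    by (auto simp: Sym_pos_def)
qed (auto simp: Sym_pos_def permutes_compose permutes_id comp_assoc)

lemma elem_transp_closed: "elem_transp ` {1..} \<subseteq> carrier Sym_pos"
  by (auto simp: Sym_pos_def intro!: permutes_swap_id)

lemma group_S_inf: "group S_inf"
  unfolding S_inf_def
  by (intro subgroup.subgroup_is_group[OF group.generate_is_subgroup[OF group_Sym_pos]]
        elem_transp_closed group_Sym_pos)

lemma transp_prod_append: "transp_prod (is @ js) = transp_prod is \<circ> transp_prod js"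
  by (induction "is") (auto simp: transp_prod_def)

lemma S_inf_factorization:
  assumes "p \<in> carrier S_inf"
  shows "\<exists>is. set is \<subseteq> {1..} \<and> transp_prod is = p"
proof -
  have gen: "\<exists>is. set is \<subseteq> {1..} \<and> transp_prod is = elem_transp i" if "i \<ge> 1" for i
    using that by (intro exI[of _ "[i]"]) (auto simp: transp_prod_def)
  have "p \<in> generate Sym_pos (elem_transp ` {1..})"
    using assms by (simp add: S_inf_def)
  then show ?thesis
  proof induction
    case one
    show ?case by (intro exI[of _ "[]"]) (auto simp: transp_prod_def Sym_pos_def)
  next
    case (incl h)
    then show ?case using gen by auto
  next
    case (inv h)
    then obtain i where i: "i \<ge> 1" "h = elem_transp i" by auto
    have "h \<in> carrier Sym_pos" using inv elem_transp_closed by blast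
    moreover have "h \<otimes>\<^bsub>Sym_pos\<^esub> h = \<one>\<^bsub>Sym_pos\<^esub>" by (simp add: i Sym_pos_def)
    ultimately have "inv\<^bsub>Sym_pos\<^esub> h = h"
      by (simp add: group.inv_equality[OF group_Sym_pos])
    then show ?case using gen i by simp
  next
    case (eng h1 h2)
    then obtain "is" js where "set is \<subseteq> {1..}" "transp_prod is = h1"
      "set js \<subseteq> {1..}" "transp_prod js = h2" by blast
    then show ?case
      by (intro exI[of _ "is @ js"]) (auto simp: transp_prod_append Sym_pos_def)
  qed
qed

lemma supp_gen_act: "supp (gen_act i a) = elem_transp i ` supp a"
proof -
  have "j \<in> supp (gen_act i a) \<longleftrightarrow> elem_transp i j \<in> supp a" for j
    by (auto simp: supp_def gen_act_def transpose_def)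
  moreover have "elem_transp i j \<in> supp a \<longleftrightarrow> j \<in> elem_transp i ` supp a" for j
    by (metis (no_types, lifting) image_iff transpose_involutory)
  ultimately show ?thesis by blast
qed

lemma assoc_perm_gen_act:
  assumes fin: "finite (supp a)"
  shows "assoc_perm (gen_act i a) = assoc_perm a"
proof (cases "a i = 0 \<or> a (Suc i) = 0")
  case False
  then show ?thesis by (simp add: gen_act_def)
next
  case True
  let ?s = "elem_transp i" and ?L = "sorted_list_of_set (supp a)"
  have mono: "?s x < ?s y" if "x \<in> supp a" "y \<in> supp a" "x < y" for x y
    using that True by (auto simp: supp_def transpose_def)
  have "sorted_wrt (<) (map ?s ?L)"
    unfolding sorted_wrt_map
    by (rule sorted_wrt_mono_rel[of _ "(<)"])
      (use fin in \<open>auto intro!: mono strict_sorted_list_of_set\<close>)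
  then have "sorted_list_of_set (?s ` supp a) = map ?s ?L"
    using fin by (intro sorted_distinct_set_unique) (auto simp: strict_sorted_iff)
  moreover have "gen_act i a (?s x) = a x" for x
    using True by (auto simp: gen_act_def transpose_def)
  ultimately show ?thesis
    by (simp add: assoc_perm_def supp_gen_act)
qed

lemma gen_act_in_E:
  assumes "a \<in> E" "i \<ge> 1"
  shows "gen_act i a \<in> E"
  using assms by (auto simp: E_def supp_gen_act assoc_perm_gen_act) (simp add: gen_act_def)

lemma gen_act_list:
  assumes "a \<in> E" "set is \<subseteq> {1..}"
  shows "foldr gen_act is a \<in> E"
    and "supp (foldr gen_act is a) = transp_prod is ` supp a"
    and "assoc_perm (foldr gen_act is a) = assoc_perm a"
proof -
  have "foldr gen_act is a \<in> E \<and> supp (foldr gen_act is a) = transp_prod is ` supp a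
      \<and> assoc_perm (foldr gen_act is a) = assoc_perm a"
    using assms(2)
  proof (induction "is")
    case Nil
    then show ?case using assms(1) by (simp add: transp_prod_def)
  next
    case (Cons i "is")
    then have IH: "foldr gen_act is a \<in> E" "finite (supp (foldr gen_act is a))"
      "supp (foldr gen_act is a) = transp_prod is ` supp a"
      "assoc_perm (foldr gen_act is a) = assoc_perm a"
      by (auto simp: E_def)
    with Cons.prems show ?case
      by (simp add: gen_act_in_E supp_gen_act assoc_perm_gen_act)
        (simp add: transp_prod_def image_comp)
  qed
  then show "foldr gen_act is a \<in> E"
    and "supp (foldr gen_act is a) = transp_prod is ` supp a"
    and "assoc_perm (foldr gen_act is a) = assoc_perm a" by auto
qed

lemma E_eqI:
  assumes "a \<in> E" "b \<in> E" "supp a = supp b" "assoc_perm a = assoc_perm b"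
  shows "a = b"
proof
  fix j
  have "a x = b x" if "x \<in> supp a" for x
    using assms that by (auto simp: assoc_perm_def E_def)
  moreover have "a j = 0 \<and> b j = 0" if "j \<notin> supp a"
    using that that[unfolded assms(3)] by (simp add: supp_def)
  ultimately show "a j = b j" by (cases "j \<in> supp a") auto
qed

lemma seq_act_eqI:
  assumes a: "a \<in> E" and s: "set is \<subseteq> {1..}" "transp_prod is = p"
  shows "seq_act p a = foldr gen_act is a"
proof -
  define js where "js = (SOME is. set is \<subseteq> {1..} \<and> transp_prod is = p)"
  have js: "set js \<subseteq> {1..} \<and> transp_prod js = p"
    unfolding js_def by (rule someI[of _ "is"]) (use s in simp)
  have "foldr gen_act js a = foldr gen_act is a"
    using js s a by (intro E_eqI) (simp_all add: gen_act_list)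
  then show ?thesis using a by (simp add: seq_act_def js_def)
qed

lemma seq_act_elem_transp:
  assumes "a \<in> E" "i \<ge> 1"
  shows "seq_act (elem_transp i) a = gen_act i a"
  using seq_act_eqI[of a "[i]"] assms by (simp add: transp_prod_def)

lemma seq_act_id: "a \<in> E \<Longrightarrow> seq_act id a = a"
  using seq_act_eqI[of a "[]"] by (simp add: transp_prod_def)

lemma seq_act_in_E:
  assumes "a \<in> E" "p \<in> carrier S_inf"
  shows "seq_act p a \<in> E"
  using S_inf_factorization[OF assms(2)] seq_act_eqI[OF assms(1)] gen_act_list(1)[OF assms(1)]
  by metis

lemma seq_act_comp:
  assumes "a \<in> E" "p \<in> carrier S_inf" "q \<in> carrier S_inf"
  shows "seq_act (p \<circ> q) a = seq_act p (seq_act q a)"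
proof -
  obtain "is" js where ij: "set is \<subseteq> {1..}" "transp_prod is = p" "set js \<subseteq> {1..}" "transp_prod js = q"
    using S_inf_factorization assms by metis
  have "seq_act q a = foldr gen_act js a"
    using ij assms by (intro seq_act_eqI)
  moreover have "seq_act p (foldr gen_act js a) = foldr gen_act is (foldr gen_act js a)"
    using ij assms by (intro seq_act_eqI gen_act_list)
  moreover have "seq_act (p \<circ> q) a = foldr gen_act (is @ js) a"
    using ij assms by (intro seq_act_eqI) (auto simp: transp_prod_append)
  ultimately show ?thesis by simp
qed

lemma group_action_seq_act: "group_action S_inf E seq_act"
proof -
  have one: "\<one>\<^bsub>S_inf\<^esub> = id" and mult: "p \<otimes>\<^bsub>S_inf\<^esub> q = p \<circ> q" for p q
    by (simp_all add: S_inf_def Sym_pos_def)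
  have inverse: "\<exists>q\<in>carrier S_inf. q \<circ> p = id \<and> p \<circ> q = id" if "p \<in> carrier S_inf" for p
    using that group.l_inv[OF group_S_inf that] group.r_inv[OF group_S_inf that]
      group.inv_closed[OF group_S_inf that] by (metis one mult)
  have bij: "seq_act p \<in> Bij E" if p: "p \<in> carrier S_inf" for p
  proof -
    obtain q where q: "q \<in> carrier S_inf" "q \<circ> p = id" "p \<circ> q = id"
      using inverse[OF p] by blast
    have "bij_betw (seq_act p) E E"
      by (rule bij_betw_byWitness[where f' = "seq_act q"])
        (use p q in \<open>auto simp: seq_act_in_E seq_act_id simp flip: seq_act_comp\<close>)
    then show ?thesis by (simp add: Bij_def seq_act_def)
  qed
  have "seq_act (p \<circ> q) = compose E (seq_act p) (seq_act q)"
    if "p \<in> carrier S_inf" "q \<in> carrier S_inf" for p q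
  proof (rule extensionalityI[of _ E])
    show "seq_act (p \<circ> q) \<in> extensional E"
      unfolding seq_act_def by (rule restrict_extensional)
  qed (use that in \<open>auto simp: seq_act_comp compose_def\<close>)
  then have "seq_act \<in> hom S_inf (BijGroup E)"
    by (auto simp: hom_def BijGroup_def bij mult)
  then show ?thesis
    by (simp add: group_action_def group_hom_def group_hom_axioms_def group_S_inf group_BijGroup)
qed

section \<open>Formal linear combinations of words and \<open>FQSym*\<close>\<close>

text \<open>An infinite formal linear combination of words is its coefficient function, extended by
  \<open>0\<close> to lists that are not words.\<close>

definition formal_sums :: "(nat list \<Rightarrow> 'k::field_char_0) set" where
  "formal_sums = {x. \<forall>w. w \<notin> words \<longrightarrow> x w = 0}"

abbreviation sum_of_words :: "nat list set \<Rightarrow> nat list \<Rightarrow> 'k::field_char_0" where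
  "sum_of_words A \<equiv> indicator A"

definition scale_formal :: "'k::field_char_0 \<Rightarrow> (nat list \<Rightarrow> 'k) \<Rightarrow> nat list \<Rightarrow> 'k" where
  "scale_formal c x = (\<lambda>w. c * x w)"

global_interpretation formal: vector_space scale_formal
  by unfold_locales (auto simp: scale_formal_def fun_eq_iff algebra_simps)

definition G :: "nat list \<Rightarrow> nat list \<Rightarrow> 'k::field_char_0" where
  "G \<sigma> = sum_of_words {w \<in> words. Std w = \<sigma>}"

definition FQSym_dual :: "(nat list \<Rightarrow> 'k::field_char_0) set" where
  "FQSym_dual = formal.span (G ` perm_words)"

text \<open>A linear span consists of finite combinations, so the elements of \<open>FQSym_dual\<close> have bounded
  degree. An invariant formal sum of unbounded degree, such as the sum of all words, lies only in
  the completion of \<open>FQSym_dual\<close> with respect to the degree.\<close>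

definition bounded_degree :: "(nat list \<Rightarrow> 'k::field_char_0) \<Rightarrow> bool" where
  "bounded_degree x \<longleftrightarrow> (\<exists>d. \<forall>w. x w \<noteq> 0 \<longrightarrow> length w \<le> d)"

definition homogeneous_part :: "nat \<Rightarrow> (nat list \<Rightarrow> 'k::field_char_0) \<Rightarrow> nat list \<Rightarrow> 'k" where
  "homogeneous_part n x = (\<lambda>w. if length w = n then x w else 0)"

definition FQSym_dual_completion :: "(nat list \<Rightarrow> 'k::field_char_0) set" where
  "FQSym_dual_completion = {x. \<forall>n. homogeneous_part n x \<in> FQSym_dual}"

text \<open>Linear extension: the coefficient of \<open>v\<close> in \<open>p \<cdot> \<Sum>\<^sub>w x\<^sub>w w\<close> collects the \<open>x\<^sub>w\<close> with
  \<open>p \<cdot> w = v\<close> (there is exactly one such \<open>w\<close> if \<open>v\<close> is a word).\<close>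

definition formal_act :: "(nat \<Rightarrow> nat) \<Rightarrow> (nat list \<Rightarrow> 'k::field_char_0) \<Rightarrow> nat list \<Rightarrow> 'k" where
  "formal_act p x = (\<lambda>v. \<Sum>w\<in>{w \<in> words. word_act p w = v}. x w)"

definition fqs_invariant :: "(nat list \<Rightarrow> 'k::field_char_0) \<Rightarrow> bool" where
  "fqs_invariant x \<longleftrightarrow> (\<forall>p\<in>carrier S_inf. formal_act p x = x)"

end

theory Submission
  imports Defs
begin

text \<open>
  A word \<open>w\<close> with \<open>\<tau> = Std(w)\<^sup>-\<^sup>1\<close> has its letters sorted as \<open>x\<^sub>1 \<le> \<dots> \<le> x\<^sub>n\<close>, strictly increasing
  at the descents of \<open>\<tau>\<close>, and \<open>f(w)\<close> has \<open>\<tau>\<^sub>i\<close> at position \<open>x\<^sub>i + asc\<^sub>i\<close>, where \<open>asc\<^sub>i\<close> is the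
  number of ascents of \<open>\<tau>\<close> before \<open>i\<close>. Adding the ascents turns the admissible \<open>x\<close> into arbitrary
  strictly increasing sequences of positive integers, so \<open>f\<close> is a bijection onto \<open>E\<close> under which
  \<open>Std(w)\<close> corresponds to the associated permutation. The action preserves the associated
  permutation and moves the support by the natural action of the symmetric group, which is transitive
  on \<open>n\<close>-element sets; hence the orbits are the classes of equal standardization. A formal sum is
  therefore invariant iff it is constant on these classes, and a constant-on-classes sum of bounded
  degree is the finite combination of the \<open>G\<^sub>\<sigma>\<close> with coefficients its values at \<open>\<sigma>\<close>.
\<close>

section \<open>Permutations of [n] as words\<close>

abbreviation perms :: "nat \<Rightarrow> nat list set" where
  "perms n \<equiv> permutations_of_set {1..n}"

lemma permsD:
  assumes "\<sigma> \<in> perms n"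
  shows "length \<sigma> = n" "set \<sigma> = {1..n}" "distinct \<sigma>"
  using length_finite_permutations_of_set[OF assms] permutations_of_setD[OF assms] by auto

lemma perms_nth_bounds:
  assumes "\<sigma> \<in> perms n" "i < n"
  shows "1 \<le> \<sigma> ! i" "\<sigma> ! i \<le> n"
  using nth_mem[of i \<sigma>] permsD[OF assms(1)] assms(2) by auto

lemma permsI:
  assumes "length \<sigma> = n" "set \<sigma> \<subseteq> {1..n}" "distinct \<sigma>"
  shows "\<sigma> \<in> perms n"
proof -
  have "card (set \<sigma>) = card {1..n}"
    using assms distinct_card by fastforce
  then have "set \<sigma> = {1..n}"
    using assms(2) by (simp add: card_subset_eq)
  then show ?thesis
    using assms(3) by (rule permutations_of_setI)
qed

lemma perms_subset_words: "perms n \<subseteq> words"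
  using permsD(2) by (fastforce simp: words_def)

lemma perm_words_iff: "\<sigma> \<in> perm_words \<longleftrightarrow> \<sigma> \<in> perms (length \<sigma>)"
  unfolding perm_words_def using permsD(1) by fast

section \<open>Standardization as the ranking of positions\<close>

lemma length_Std [simp]: "length (Std w) = length w"
  by (simp add: Std_def)

text \<open>The two sets counted in \<open>Std\<close> are disjoint; their union exhibits the value
  as the rank of position \<open>i\<close> when positions are ordered by letter and then from left
  to right.\<close>

lemma Std_nth:
  assumes "i < length w"
  shows "Std w ! i = card {j. j < length w \<and> (w ! j < w ! i \<or> w ! j = w ! i \<and> j \<le> i)}"
proof -
  have "{j. j < length w \<and> (w ! j < w ! i \<or> w ! j = w ! i \<and> j \<le> i)} =
      {j. j < length w \<and> w ! j < w ! i} \<union> {j. j \<le> i \<and> w ! j = w ! i}"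
    using assms by auto
  also have "card \<dots> = card {j. j < length w \<and> w ! j < w ! i} + card {j. j \<le> i \<and> w ! j = w ! i}"
    by (rule card_Un_disjoint) auto
  finally show ?thesis
    using assms by (simp add: Std_def)
qed

text \<open>The sets counted in \<open>Std_nth\<close> are initial segments of a linear order on
  positions, hence nested, so comparing their sizes compares the positions.\<close>

lemma Std_le_iff:
  assumes "i < length w" "j < length w"
  shows "Std w ! i \<le> Std w ! j \<longleftrightarrow> w ! i < w ! j \<or> w ! i = w ! j \<and> i \<le> j"
proof -
  let ?R = "\<lambda>i. {j. j < length w \<and> (w ! j < w ! i \<or> w ! j = w ! i \<and> j \<le> i)}"
  have "?R i \<subseteq> ?R j" if "w ! i < w ! j \<or> w ! i = w ! j \<and> i \<le> j"
    using that by auto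
  then have "card (?R i) \<le> card (?R j)" if "w ! i < w ! j \<or> w ! i = w ! j \<and> i \<le> j"
    using that by (intro card_mono) auto
  moreover have "?R j \<subset> ?R i" if "\<not> (w ! i < w ! j \<or> w ! i = w ! j \<and> i \<le> j)"
  proof
    show "?R j \<subseteq> ?R i" using that by auto
    have "i \<in> ?R i" "i \<notin> ?R j" using that assms by auto
    then show "?R j \<noteq> ?R i" by blast
  qed
  then have "card (?R j) < card (?R i)" if "\<not> (w ! i < w ! j \<or> w ! i = w ! j \<and> i \<le> j)"
    using that by (intro psubset_card_mono) auto
  ultimately show ?thesis
    unfolding Std_nth[OF assms(1)] Std_nth[OF assms(2)] by (meson not_le)
qed

lemma Std_in_perms: "Std w \<in> perms (length w)"
proof (rule permsI)
  show "set (Std w) \<subseteq> {1..length w}"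
  proof
    fix v assume "v \<in> set (Std w)"
    then obtain i where i: "i < length w" "v = Std w ! i"
      by (auto simp: in_set_conv_nth)
    let ?R = "{j. j < length w \<and> (w ! j < w ! i \<or> w ! j = w ! i \<and> j \<le> i)}"
    have "card ?R \<le> card {..<length w}"
      by (intro card_mono) auto
    moreover have "card ?R > 0"
      using i by (auto simp: card_gt_0_iff)
    ultimately show "v \<in> {1..length w}"
      using i by (simp add: Std_nth)
  qed
  show "distinct (Std w)"
    unfolding distinct_conv_nth
  proof (intro allI impI notI)
    fix i j assume "i < length (Std w)" "j < length (Std w)" "i \<noteq> j" "Std w ! i = Std w ! j"
    then show False
      using Std_le_iff[of i w j] Std_le_iff[of j w i] by auto
  qed
qed simp

text \<open>A permutation is its own rank function: \<open>\<sigma> ! i\<close> is the number of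
  positions whose value is at most \<open>\<sigma> ! i\<close>. So the order it induces on positions
  determines it.\<close>

lemma Std_eqI:
  assumes \<sigma>: "\<sigma> \<in> perms (length w)"
    and le: "\<And>i j. i < length w \<Longrightarrow> j < length w \<Longrightarrow>
      \<sigma> ! i \<le> \<sigma> ! j \<longleftrightarrow> w ! i < w ! j \<or> w ! i = w ! j \<and> i \<le> j"
  shows "Std w = \<sigma>"
proof (rule nth_equalityI)
  show len: "length (Std w) = length \<sigma>"
    using permsD(1)[OF \<sigma>] by simp
  fix i assume "i < length (Std w)"
  then have i: "i < length w" by simp
  let ?R = "{j. j < length w \<and> \<sigma> ! j \<le> \<sigma> ! i}"
  have "(!) \<sigma> ` ?R = {1..\<sigma> ! i}"
  proof (intro equalityI subsetI)
    fix v assume v: "v \<in> {1..\<sigma> ! i}"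
    then have "v \<in> set \<sigma>"
      using perms_nth_bounds[OF \<sigma> i] permsD(2)[OF \<sigma>] by auto
    then show "v \<in> (!) \<sigma> ` ?R"
      using v len by (auto simp: in_set_conv_nth)
  qed (use perms_nth_bounds[OF \<sigma>] in force)
  moreover have "inj_on ((!) \<sigma>) ?R"
    using permsD[OF \<sigma>] by (auto intro: inj_on_nth)
  ultimately have "card ?R = \<sigma> ! i"
    using card_image by fastforce
  moreover have "Std w ! i = card ?R"
    unfolding Std_nth[OF i] using le i by (intro arg_cong[where f = card] Collect_cong) blast
  ultimately show "Std w ! i = \<sigma> ! i" by simp
qed

text \<open>Distinct letters leave no ties to break. Each permutation thus represents its own class
  of equal standardization.\<close>

lemma Std_perm:
  assumes "\<sigma> \<in> perms n"
  shows "Std \<sigma> = \<sigma>"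
proof (rule Std_eqI)
  show "\<sigma> \<in> perms (length \<sigma>)"
    using assms permsD(1)[OF assms] by metis
  show "\<sigma> ! i \<le> \<sigma> ! j \<longleftrightarrow> \<sigma> ! i < \<sigma> ! j \<or> \<sigma> ! i = \<sigma> ! j \<and> i \<le> j"
    if "i < length \<sigma>" "j < length \<sigma>" for i j
    using that permsD(3)[OF assms] nth_eq_iff_index_eq[of \<sigma> i j] by auto
qed

section \<open>The inverse of a permutation in one-line notation\<close>

lemma length_inverse_word [simp]: "length (inverse_word \<sigma>) = length \<sigma>"
  by (simp add: inverse_word_def del: upt_Suc)

lemma inverse_word_nth:
  assumes "\<sigma> \<in> perms n" "i < n"
  shows "inverse_word \<sigma> ! (\<sigma> ! i - 1) = Suc i"
proof -
  note \<sigma> = permsD[OF assms(1)] and b = perms_nth_bounds[OF assms]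
  let ?k = "length (takeWhile (\<lambda>u. u \<noteq> \<sigma> ! i) \<sigma>)"
  have "takeWhile (\<lambda>u. u \<noteq> \<sigma> ! i) \<sigma> \<noteq> \<sigma>"
    using assms(2) \<sigma>(1) by (auto simp: takeWhile_eq_all_conv)
  then have "?k < length \<sigma>"
    by (metis leI take_all takeWhile_eq_take)
  moreover from this have "\<sigma> ! ?k = \<sigma> ! i"
    using nth_length_takeWhile by blast
  ultimately have "?k = i"
    using \<sigma> assms by (simp add: nth_eq_iff_index_eq)
  moreover have "[1..<Suc (length \<sigma>)] ! (\<sigma> ! i - 1) = \<sigma> ! i"
    using b \<sigma> by (subst nth_upt) auto
  ultimately show ?thesis
    using b \<sigma> by (simp add: inverse_word_def del: upt_Suc)
qed

lemma perms_index:
  assumes "\<sigma> \<in> perms n" "v < n"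
  obtains i where "i < n" "\<sigma> ! i = Suc v" "inverse_word \<sigma> ! v = Suc i"
proof -
  have "Suc v \<in> set \<sigma>" using assms permsD(2)[OF assms(1)] by simp
  then obtain i where "i < n" "\<sigma> ! i = Suc v"
    using permsD(1)[OF assms(1)] by (auto simp: in_set_conv_nth)
  moreover from this have "inverse_word \<sigma> ! v = Suc i"
    using inverse_word_nth[OF assms(1), of i] by simp
  ultimately show thesis by (rule that)
qed

lemma inverse_word_in_perms:
  assumes "\<sigma> \<in> perms n"
  shows "inverse_word \<sigma> \<in> perms n"
proof (rule permsI)
  note len = permsD(1)[OF assms]
  show "length (inverse_word \<sigma>) = n" using len by simp
  show "set (inverse_word \<sigma>) \<subseteq> {1..n}"
  proof
    fix u assume "u \<in> set (inverse_word \<sigma>)"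
    then obtain v where "v < n" "u = inverse_word \<sigma> ! v"
      using len by (auto simp: in_set_conv_nth)
    then show "u \<in> {1..n}" by (auto elim: perms_index[OF assms])
  qed
  show "distinct (inverse_word \<sigma>)"
    unfolding distinct_conv_nth length_inverse_word len
  proof (intro allI impI notI)
    fix u v assume "u < n" "v < n" "u \<noteq> v" "inverse_word \<sigma> ! u = inverse_word \<sigma> ! v"
    then show False
      using perms_index[OF assms, of u] perms_index[OF assms, of v] by (metis nat.inject)
  qed
qed

lemma inverse_word_involutive:
  assumes "\<sigma> \<in> perms n"
  shows "inverse_word (inverse_word \<sigma>) = \<sigma>"
proof (rule nth_equalityI)
  fix i assume "i < length (inverse_word (inverse_word \<sigma>))"
  then have i: "i < n" using permsD(1)[OF assms] by simp
  have "\<sigma> ! i - 1 < n" "\<sigma> ! i = Suc (\<sigma> ! i - 1)"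
    using perms_nth_bounds[OF assms i] by auto
  then show "inverse_word (inverse_word \<sigma>) ! i = \<sigma> ! i"
    using inverse_word_nth[OF inverse_word_in_perms[OF assms], of "\<sigma> ! i - 1"]
      inverse_word_nth[OF assms i] by simp
qed simp

lemma nth_inverse_word:
  assumes "\<sigma> \<in> perms n" "v < n"
  shows "\<sigma> ! (inverse_word \<sigma> ! v - 1) = Suc v"
  by (rule perms_index[OF assms]) simp

section \<open>Positions and values of the nonzero entries of f(w)\<close>

definition ascents :: "(nat \<Rightarrow> nat) \<Rightarrow> nat \<Rightarrow> nat" where
  "ascents t i = (\<Sum>k<i. of_bool (t k < t (Suc k)))"

lemma ascents_0 [simp]: "ascents t 0 = 0"
  and ascents_Suc [simp]: "ascents t (Suc i) = ascents t i + of_bool (t i < t (Suc i))"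
  by (simp_all add: ascents_def)

text \<open>Indices start at \<open>0\<close>: \<open>place w i\<close> is \<open>\<tau>\<^bsub>i+1\<^esub>\<close>, and \<open>code_pos w i\<close> is the position of \<open>\<tau>\<^bsub>i+1\<^esub>\<close>
  in \<open>f(w)\<close>. The gap between consecutive nonzero entries is the increase of the letters, plus one
  exactly at the ascents of \<open>\<tau>\<close>.\<close>

definition place :: "nat list \<Rightarrow> nat \<Rightarrow> nat" where
  "place w i = inverse_word (Std w) ! i"

definition letter :: "nat list \<Rightarrow> nat \<Rightarrow> nat" where
  "letter w i = w ! (place w i - 1)"

definition code_pos :: "nat list \<Rightarrow> nat \<Rightarrow> nat" where
  "code_pos w i = letter w i + ascents (place w) i"

lemma place_bounds:
  assumes "i < length w"
  shows "1 \<le> place w i" "place w i \<le> length w"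
  using perms_nth_bounds[OF inverse_word_in_perms[OF Std_in_perms] assms]
  by (simp_all add: place_def)

text \<open>The two places are positions with consecutive values in \<open>Std w\<close>, so
  \<open>Std_le_iff\<close> orders them by letter and, on a tie, from left to right.\<close>

lemma letter_step:
  assumes "Suc i < length w"
  shows "letter w i < letter w (Suc i) \<or>
    letter w i = letter w (Suc i) \<and> place w i < place w (Suc i)"
proof -
  let ?j = "place w i - 1" and ?k = "place w (Suc i) - 1"
  have jk: "?j < length w" "?k < length w" "1 \<le> place w i" "1 \<le> place w (Suc i)"
    using assms place_bounds[of i w] place_bounds[of "Suc i" w] by auto
  have S: "Std w ! ?j = Suc i" "Std w ! ?k = Suc (Suc i)"
    using assms nth_inverse_word[OF Std_in_perms] by (simp_all add: place_def)
  then have "?j \<noteq> ?k" by auto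
  moreover have "w ! ?j < w ! ?k \<or> w ! ?j = w ! ?k \<and> ?j \<le> ?k"
    using Std_le_iff[OF jk(1,2)] S by simp
  ultimately show ?thesis
    using jk(3,4) by (auto simp: letter_def)
qed

text \<open>A tie between the letters forces an ascent of \<open>place w\<close>, which then
  contributes the increase.\<close>

lemma code_pos_step: "Suc i < length w \<Longrightarrow> code_pos w i < code_pos w (Suc i)"
  using letter_step[of i w] by (auto simp: code_pos_def)

lemma code_pos_strict_mono:
  assumes "i < j" "j < length w"
  shows "code_pos w i < code_pos w j"
  using assms(2,1)
proof (induction j)
  case (Suc j)
  then show ?case
    using code_pos_step[of j w] by (cases "i = j") auto
qed simp

lemma letter_pos:
  assumes "w \<in> words" "i < length w"
  shows "letter w i > 0"
proof -
  have "letter w i \<in> set w"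
    using place_bounds[OF assms(2)] by (auto simp: letter_def)
  then show ?thesis
    using assms(1) by (metis (mono_tags) gr0I mem_Collect_eq words_def)
qed

text \<open>Each block of zeros is closed by one nonzero entry, and \<open>P i\<close> is the
  1-based position where block \<open>i\<close> ends. The induction appends one block at a
  time.\<close>

lemma code_blocks:
  fixes z t :: "nat \<Rightarrow> nat" and n :: nat
  defines "L \<equiv> concat (map (\<lambda>i. replicate (z i) 0 @ [t i]) [0..<n])"
    and "P \<equiv> (\<lambda>i. \<Sum>k\<le>i. z k + 1)"
  assumes t: "\<And>i. i < n \<Longrightarrow> t i > 0"
  defines "b \<equiv> (\<lambda>j. if 1 \<le> j \<and> j \<le> length L then L ! (j - 1) else 0)"
  shows "supp b = P ` {..<n}" and "\<And>i. i < n \<Longrightarrow> b (P i) = t i"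
proof -
  define M where "M m = concat (map (\<lambda>i. replicate (z i) 0 @ [t i]) [0..<m])" for m
  define c where "c m = (\<lambda>j. if 1 \<le> j \<and> j \<le> length (M m) then M m ! (j - 1) else 0)" for m
  have M_Suc: "M (Suc m) = M m @ replicate (z m) 0 @ [t m]" for m
    by (simp add: M_def)
  have len: "length (M (Suc m)) = P m" for m
  proof (induction m)
    case (Suc m)
    then show ?case by (subst M_Suc) (simp add: P_def)
  qed (simp add: M_def P_def)
  have len': "P m = Suc (length (M m) + z m)" for m
    using len[of m] by (simp add: M_Suc)
  \<comment> \<open>The appended zeros agree with the default value \<open>0\<close> beyond the
    list, so only the closing entry changes the function.\<close>
  have upd: "c (Suc m) = (c m)(P m := t m)" for m
  proof
    fix j
    show "c (Suc m) j = ((c m)(P m := t m)) j"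
      unfolding c_def M_Suc len' by (auto simp: nth_append)
  qed
  have "supp (c m) = P ` {..<m} \<and> (\<forall>i<m. c m (P i) = t i)" if "m \<le> n" for m
    using that
  proof (induction m)
    case 0
    then show ?case by (simp add: c_def M_def supp_def)
  next
    case (Suc m)
    \<comment> \<open>Strict growth of \<open>P\<close> ensures that the update does not overwrite
      an earlier entry.\<close>
    have "P i < P m" if "i < m" for i
      using that unfolding P_def by (intro sum_strict_mono2[of _ _ m]) auto
    then have "P i \<noteq> P m" if "i < m" for i
      using that by (metis less_irrefl)
    then have "\<forall>i<Suc m. c (Suc m) (P i) = t i"
      using Suc by (auto simp: upd less_Suc_eq)
    moreover have "supp (c (Suc m)) = insert (P m) (supp (c m))"
      using Suc.prems t[of m] by (auto simp: upd supp_def)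
    ultimately show ?case
      using Suc by (simp add: lessThan_Suc)
  qed
  moreover have "b = c n"
    unfolding b_def c_def L_def M_def ..
  ultimately show "supp b = P ` {..<n}" "\<And>i. i < n \<Longrightarrow> b (P i) = t i"
    by auto
qed

lemma encode_code:
  assumes w: "w \<in> words"
  shows "supp (encode w) = code_pos w ` {..<length w}"
    and "\<And>i. i < length w \<Longrightarrow> encode w (code_pos w i) = place w i"
proof -
  define z where "z i = (if i = 0 then letter w 0 - 1
      else if place w (i - 1) < place w i then letter w i - letter w (i - 1)
      else letter w i - letter w (i - 1) - 1)" for i
  have L: "encode_list w = concat (map (\<lambda>i. replicate (z i) 0 @ [place w i]) [0..<length w])"
    unfolding encode_list_def Let_def z_def letter_def place_def ..
  \<comment> \<open>The sum telescopes: by \<open>letter_pos\<close> and \<open>letter_step\<close>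
    no subtraction in \<open>z\<close> truncates, and the added ones survive exactly at the
    ascents.\<close>
  have P: "(\<Sum>k\<le>i. z k + 1) = code_pos w i" if "i < length w" for i
    using that
  proof (induction i)
    case 0
    then show ?case using letter_pos[OF w, of 0] by (simp add: z_def code_pos_def)
  next
    case (Suc i)
    then show ?case
      using letter_step[of i w] by (auto simp: z_def code_pos_def)
  qed
  have t: "place w i > 0" if "i < length w" for i
    using place_bounds[OF that] by simp
  have supp: "supp (encode w) = (\<lambda>i. \<Sum>k\<le>i. z k + 1) ` {..<length w}"
    unfolding encode_def L by (rule code_blocks(1)[OF t])
  have val: "encode w (\<Sum>k\<le>i. z k + 1) = place w i" if "i < length w" for i
    unfolding encode_def L by (rule code_blocks(2)[OF t that])
  show "supp (encode w) = code_pos w ` {..<length w}"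
    unfolding supp using P by (intro image_cong) auto
  show "encode w (code_pos w i) = place w i" if "i < length w" for i
    using val[OF that] P[OF that] by simp
qed

section \<open>The encoding as a bijection onto E\<close>

lemma sorted_list_of_set_strict_mono_image:
  fixes p :: "nat \<Rightarrow> nat"
  assumes "\<And>i j. i < j \<Longrightarrow> j < n \<Longrightarrow> p i < p j"
  shows "sorted_list_of_set (p ` {..<n}) = map p [0..<n]"
proof -
  have "sorted_wrt (<) (map p [0..<n])"
    using assms by (auto simp: sorted_wrt_iff_nth_less)
  then show ?thesis
    by (intro sorted_distinct_set_unique) (auto simp: strict_sorted_iff atLeast0LessThan)
qed

lemma sorted_supp_encode:
  "w \<in> words \<Longrightarrow> sorted_list_of_set (supp (encode w)) = map (code_pos w) [0..<length w]"
  by (simp add: encode_code(1) sorted_list_of_set_strict_mono_image code_pos_strict_mono)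

lemma assoc_perm_encode:
  assumes "w \<in> words"
  shows "assoc_perm (encode w) = inverse_word (Std w)"
  by (rule nth_equalityI)
    (use assms in \<open>simp_all add: assoc_perm_def sorted_supp_encode encode_code(2) place_def\<close>)

lemma encode_in_E:
  assumes "w \<in> words"
  shows "encode w \<in> E"
  using assms inverse_word_in_perms[OF Std_in_perms[of w]]
  by (auto simp: E_def assoc_perm_encode encode_code(1) perm_words_def)
    (simp add: encode_def)

lemma Std_eq_iff_inverse: "inverse_word (Std w) = inverse_word (Std w') \<longleftrightarrow> Std w = Std w'"
  using inverse_word_involutive[OF Std_in_perms] by metis

text \<open>The associated permutation gives back \<open>Std w\<close>, hence \<open>place w\<close>
  and its ascents. Subtracting these from the support leaves the sorted letters, and
  \<open>Std w\<close> tells where each of them stands.\<close>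

lemma inj_on_encode: "inj_on encode words"
proof (rule inj_onI)
  fix w w' assume w: "w \<in> words" "w' \<in> words" and eq: "encode w = encode w'"
  then have S: "Std w = Std w'"
    using assoc_perm_encode Std_eq_iff_inverse by metis
  then have len: "length w = length w'"
    using length_Std by metis
  have pl: "place w = place w'"
    using S by (simp add: place_def fun_eq_iff)
  have "map (code_pos w) [0..<length w] = map (code_pos w') [0..<length w]"
    using sorted_supp_encode w eq len by metis
  then have lt: "letter w i = letter w' i" if "i < length w" for i
    using that by (simp add: code_pos_def pl)
  show "w = w'"
  proof (rule nth_equalityI)
    fix i assume i: "i < length w"
    then have b: "Std w ! i - 1 < length w"
      using perms_nth_bounds[OF Std_in_perms i] by simp
    have "place w (Std w ! i - 1) = Suc i"
      using inverse_word_nth[OF Std_in_perms i] by (simp add: place_def)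
    then show "w ! i = w' ! i"
      using lt[OF b] pl by (simp add: letter_def)
  qed (rule len)
qed

text \<open>The preimage comes from inverting the formula for \<open>code_pos\<close>: each support
  position is lowered by the number of preceding ascents of the associated permutation.\<close>

lemma encode_surj:
  assumes a: "a \<in> E"
  obtains w where "w \<in> words" "encode w = a"
proof -
  define n where "n = card (supp a)"
  define p where "p i = sorted_list_of_set (supp a) ! i" for i
  define \<tau> where "\<tau> = assoc_perm a"
  define \<sigma> where "\<sigma> = inverse_word \<tau>"
  define x where "x i = p i - ascents ((!) \<tau>) i" for i
  \<comment> \<open>Position \<open>v\<close> receives the letter of rank
    \<open>\<sigma> ! v\<close>; ranks start at 1 and indices at 0.\<close>
  define w where "w = map (\<lambda>v. x (\<sigma> ! v - 1)) [0..<n]"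
  have fin: "finite (supp a)" and a0: "0 \<notin> supp a"
    using a by (auto simp: E_def supp_def)
  have len_\<tau>: "length \<tau> = n"
    by (simp add: \<tau>_def assoc_perm_def n_def)
  have \<tau>: "\<tau> \<in> perms n"
    using a perm_words_iff[of \<tau>] len_\<tau> by (simp add: E_def \<tau>_def)
  have \<sigma>: "\<sigma> \<in> perms n"
    unfolding \<sigma>_def by (rule inverse_word_in_perms[OF \<tau>])
  have p_mono: "p i < p j" if "i < j" "j < n" for i j
    using that strict_sorted_list_of_set[of "supp a"]
    unfolding p_def n_def by (auto simp: sorted_wrt_iff_nth_less)
  have supp_a: "supp a = p ` {..<n}"
  proof -
    have "set (sorted_list_of_set (supp a)) = p ` {..<n}"
      by (auto simp: set_conv_nth p_def n_def)
    then show ?thesis using fin by simp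
  qed
  \<comment> \<open>The subtraction defining \<open>x\<close> is exact, since a step raises
    \<open>p\<close> by at least one and the ascent count by at most one. The start is positive
    because \<open>0\<close> lies outside the support.\<close>
  have x_pos: "x i > 0 \<and> p i = x i + ascents ((!) \<tau>) i" if "i < n" for i
    using that
  proof (induction i)
    case 0
    then have "p 0 \<in> supp a" by (auto simp: supp_a)
    then show ?case using a0 by (cases "p 0") (auto simp: x_def)
  next
    case (Suc i)
    then show ?case using p_mono[of i "Suc i"] by (auto simp: x_def)
  qed
  \<comment> \<open>Without an ascent the whole increase of \<open>p\<close> falls to
    \<open>x\<close>; with one, a weak increase remains.\<close>
  have x_step: "x i < x (Suc i) \<or> x i = x (Suc i) \<and> \<tau> ! i < \<tau> ! Suc i" if "Suc i < n" for i
    using p_mono[of i "Suc i"] x_pos[of i] x_pos[of "Suc i"] that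
    by (cases "\<tau> ! i < \<tau> ! Suc i") auto
  have x_mono: "x i < x j \<or> x i = x j \<and> \<tau> ! i < \<tau> ! j" if "i < j" "j < n" for i j
    using that(2,1)
  proof (induction j)
    case (Suc j)
    then show ?case
      using x_step[of j] by (cases "i = j") auto
  qed simp
  have len_w: "length w = n" by (simp add: w_def)
  have w_words: "w \<in> words"
  proof -
    have "x (\<sigma> ! v - 1) > 0" if "v < n" for v
      using x_pos perms_nth_bounds[OF \<sigma> that] by auto
    then show ?thesis by (fastforce simp: words_def w_def)
  qed
  have \<tau>_nth: "\<tau> ! (\<sigma> ! v - 1) = Suc v" if "v < n" for v
    using nth_inverse_word[OF \<tau> that] by (simp add: \<sigma>_def)
  have Std_w: "Std w = \<sigma>"
  proof (rule Std_eqI)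
    show "\<sigma> \<in> perms (length w)" using \<sigma> len_w by simp
    fix i j assume "i < length w" "j < length w"
    then have ij: "i < n" "j < n" using len_w by auto
    note bi = perms_nth_bounds[OF \<sigma> ij(1)] and bj = perms_nth_bounds[OF \<sigma> ij(2)]
    have w: "w ! i = x (\<sigma> ! i - 1)" "w ! j = x (\<sigma> ! j - 1)"
      using ij by (auto simp: w_def)
    consider "\<sigma> ! i < \<sigma> ! j" | "\<sigma> ! i = \<sigma> ! j" | "\<sigma> ! j < \<sigma> ! i" by linarith
    then show "\<sigma> ! i \<le> \<sigma> ! j \<longleftrightarrow> w ! i < w ! j \<or> w ! i = w ! j \<and> i \<le> j"
    proof cases
      case 1
      then have "\<sigma> ! i - 1 < \<sigma> ! j - 1" "\<sigma> ! j - 1 < n"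
        using bi bj by auto
      \<comment> \<open>On a tie of letters, the entries of \<open>\<tau>\<close> compared by
        \<open>x_mono\<close> are the positions themselves, by \<open>\<tau>_nth\<close>.\<close>
      from x_mono[OF this] show ?thesis
        using 1 w \<tau>_nth[OF ij(1)] \<tau>_nth[OF ij(2)] by auto
    next
      case 2
      then have "i = j"
        using permsD[OF \<sigma>] ij by (simp add: nth_eq_iff_index_eq)
      then show ?thesis by simp
    next
      case 3
      then have "\<sigma> ! j - 1 < \<sigma> ! i - 1" "\<sigma> ! i - 1 < n"
        using bi bj by auto
      from x_mono[OF this] show ?thesis
        using 3 w \<tau>_nth[OF ij(1)] \<tau>_nth[OF ij(2)] by auto
    qed
  qed
  have inv: "inverse_word (Std w) = \<tau>"
    unfolding Std_w \<sigma>_def by (rule inverse_word_involutive[OF \<tau>])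
  then have pl: "place w = (!) \<tau>" by (simp add: place_def fun_eq_iff)
  have "code_pos w i = p i" if i: "i < n" for i
  proof -
    have "\<sigma> ! (\<tau> ! i - 1) = Suc i"
      using inverse_word_nth[OF \<tau> i] by (simp add: \<sigma>_def)
    moreover have "\<tau> ! i - 1 < n"
      using perms_nth_bounds[OF \<tau> i] by simp
    ultimately have "letter w i = x i"
      unfolding letter_def pl by (simp add: w_def)
    then show ?thesis
      using x_pos[OF i] by (simp add: code_pos_def pl)
  qed
  then have "supp (encode w) = supp a"
    using encode_code(1)[OF w_words] supp_a len_w by simp
  then have "encode w = a"
    using encode_in_E[OF w_words] a assoc_perm_encode[OF w_words] inv
    by (intro E_eqI) (auto simp: \<tau>_def)
  with w_words show thesis by (rule that)
qed

lemma bij_betw_encode: "bij_betw encode words E"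
  unfolding bij_betw_def using inj_on_encode encode_in_E encode_surj
  by (metis image_iff image_subsetI subsetI subset_antisym)

section \<open>Transitivity on finite sets of equal size\<close>

lemma transp_prod_Cons: "transp_prod (i # is) = elem_transp i \<circ> transp_prod is"
  by (simp add: transp_prod_def)

lemma transp_prod_in_S_inf:
  assumes "set is \<subseteq> {1..}"
  shows "transp_prod is \<in> carrier S_inf"
proof -
  have "transp_prod is \<in> generate Sym_pos (elem_transp ` {1..})"
    using assms
  proof (induction "is")
    case Nil
    then show ?case
      using generate.one[of Sym_pos "elem_transp ` {1..}"]
      by (simp add: transp_prod_def Sym_pos_def id_def)
  next
    case (Cons i "is")
    then have "elem_transp i \<in> generate Sym_pos (elem_transp ` {1..})"
      by (intro generate.incl) auto
    from generate.eng[OF this] Cons show ?case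
      by (simp add: transp_prod_Cons Sym_pos_def comp_def)
  qed
  then show ?thesis by (simp add: S_inf_def)
qed

text \<open>The two factors that meet in the middle are the same involution and cancel.\<close>

lemma transp_prod_rev: "transp_prod (rev is) \<circ> transp_prod is = id"
proof (induction "is")
  case (Cons i "is")
  have "transp_prod (rev (i # is)) \<circ> transp_prod (i # is) =
      transp_prod (rev is) \<circ> (elem_transp i \<circ> elem_transp i) \<circ> transp_prod is"
    by (simp only: rev.simps transp_prod_append transp_prod_Cons comp_assoc)
      (simp add: transp_prod_def)
  with Cons show ?case by simp
qed (simp add: transp_prod_def)

text \<open>As long as \<open>A\<close> is not an initial segment, some \<open>s\<^sub>i\<close> lowers the sum of its elements.\<close>

lemma transp_prod_to_initial_segment:
  assumes "finite A" "0 \<notin> A"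
  shows "\<exists>is. set is \<subseteq> {1..} \<and> transp_prod is ` A = {1..card A}"
  using assms
proof (induction "\<Sum>A" arbitrary: A rule: less_induct)
  case less
  show ?case
  proof (cases "\<exists>i\<ge>1. i \<notin> A \<and> Suc i \<in> A")
    case True
    then obtain i where i: "i \<ge> 1" "i \<notin> A" "Suc i \<in> A" by blast
    let ?B = "elem_transp i ` A"
    have B: "?B = insert i (A - {Suc i})"
    proof (intro equalityI subsetI)
      fix j assume "j \<in> insert i (A - {Suc i})"
      then have "j = elem_transp i (elem_transp i j)" "elem_transp i j \<in> A"
        using i by (auto simp: transpose_def)
      then show "j \<in> ?B" by (rule image_eqI)
    qed (use i in \<open>auto simp: transpose_def split: if_splits\<close>)
    have "\<Sum>A = Suc i + \<Sum>(A - {Suc i})"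
      using i less.prems(1) by (simp add: sum.remove)
    moreover have "\<Sum>?B = i + \<Sum>(A - {Suc i})"
      unfolding B using i less.prems(1) by (subst sum.insert) auto
    ultimately have "\<Sum>?B < \<Sum>A" by simp
    moreover have "finite ?B" "0 \<notin> ?B"
      using less.prems i unfolding B by auto
    ultimately obtain "is" where "set is \<subseteq> {1..}" "transp_prod is ` ?B = {1..card ?B}"
      using less.hyps by blast
    moreover have "card ?B = card A"
      by (intro card_image inj_on_subset[OF inj_transpose]) simp
    \<comment> \<open>The new letter \<open>i\<close> goes to the end of the list because the last
      factor acts first.\<close>
    ultimately show ?thesis
      using i by (intro exI[of _ "is @ [i]"])
        (auto simp: transp_prod_append image_comp, auto simp: transp_prod_def)
  next
    case False
    \<comment> \<open>Without a gap below an element, \<open>A\<close> is closed downwards and so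
      reaches from 1 to its maximum.\<close>
    have down: "{1..j} \<subseteq> A" if "j \<in> A" for j
      using that
    proof (induction j)
      case (Suc j)
      then have "j = 0 \<or> j \<in> A"
        using False by (cases j) auto
      with Suc show ?case
        by (auto simp: atLeastAtMostSuc_conv)
    qed simp
    have "A = {1..card A}"
    proof (cases "A = {}")
      case False
      then have "Max A \<in> A" using less.prems(1) by simp
      moreover have "A \<subseteq> {1..Max A}"
        using less.prems by (auto simp: Suc_le_eq intro!: gr0I)
      ultimately have "A = {1..Max A}" using down by blast
      then show ?thesis by (metis card_atLeastAtMost diff_Suc_1)
    qed simp
    then show ?thesis
      by (intro exI[of _ "[]"]) (auto simp: transp_prod_def)
  qed
qed

text \<open>Both sets can be carried to the same initial segment; the product that does so for
  \<open>B\<close> is then undone by reversing it.\<close>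

lemma S_inf_transitive_on_card:
  assumes "finite A" "0 \<notin> A" "finite B" "0 \<notin> B" "card A = card B"
  obtains "is" where "set is \<subseteq> {1..}" "transp_prod is ` A = B"
proof -
  obtain "is" js where A: "set is \<subseteq> {1..}" "transp_prod is ` A = {1..card A}"
    and B: "set js \<subseteq> {1..}" "transp_prod js ` B = {1..card B}"
    using transp_prod_to_initial_segment assms by metis
  have "transp_prod (rev js @ is) ` A = transp_prod (rev js) ` transp_prod js ` B"
    unfolding transp_prod_append image_comp[symmetric] using A B assms by simp
  also have "\<dots> = B"
    by (simp add: image_comp transp_prod_rev)
  finally show thesis
    using A B by (intro that[of "rev js @ is"]) auto
qed

section \<open>Orbits and invariant formal sums\<close>

lemma orbit_seq_act:
  assumes a: "a \<in> E"
  shows "{seq_act p a |p. p \<in> carrier S_inf} = {b \<in> E. assoc_perm b = assoc_perm a}"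
proof (intro equalityI subsetI)
  fix b assume "b \<in> {seq_act p a |p. p \<in> carrier S_inf}"
  then obtain p where p: "p \<in> carrier S_inf" "b = seq_act p a" by blast
  then obtain "is" where "set is \<subseteq> {1..}" "transp_prod is = p"
    using S_inf_factorization by blast
  then show "b \<in> {b \<in> E. assoc_perm b = assoc_perm a}"
    using seq_act_eqI[OF a] gen_act_list[OF a] p by auto
next
  fix b assume "b \<in> {b \<in> E. assoc_perm b = assoc_perm a}"
  then have b: "b \<in> E" and eq: "assoc_perm b = assoc_perm a" by auto
  \<comment> \<open>Equal associated permutations force supports of equal size, as transitivity
    requires.\<close>
  have "length (assoc_perm c) = card (supp c)" for c
    by (simp add: assoc_perm_def)
  with eq have "card (supp a) = card (supp b)" by metis
  moreover have "finite (supp a)" "0 \<notin> supp a" "finite (supp b)" "0 \<notin> supp b"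
    using a b by (auto simp: E_def supp_def)
  ultimately obtain "is" where s: "set is \<subseteq> {1..}" "transp_prod is ` supp a = supp b"
    using S_inf_transitive_on_card by metis
  have "seq_act (transp_prod is) a = foldr gen_act is a"
    using a s by (intro seq_act_eqI) auto
  \<comment> \<open>The action keeps the associated permutation, which together with the support
    determines an element of \<open>E\<close>.\<close>
  also have "\<dots> = b"
    using a b s eq by (intro E_eqI) (simp_all add: gen_act_list)
  finally show "b \<in> {seq_act p a |p. p \<in> carrier S_inf}"
    using transp_prod_in_S_inf[OF s(1)] by blast
qed

lemma word_act_closed:
  assumes "w \<in> words" "p \<in> carrier S_inf"
  shows "word_act p w \<in> words" and "encode (word_act p w) = seq_act p (encode w)"
proof -
  have "seq_act p (encode w) \<in> encode ` words"
    using seq_act_in_E[OF encode_in_E] assms bij_betw_encode by (simp add: bij_betw_def)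
  then show "word_act p w \<in> words" "encode (word_act p w) = seq_act p (encode w)"
    using assms(1) by (auto simp: word_act_def inv_into_into f_inv_into_f)
qed

text \<open>On words the action is the conjugate of \<open>seq_act p\<close> by the bijection
  \<open>encode\<close>.\<close>

lemma bij_betw_word_act:
  assumes p: "p \<in> carrier S_inf"
  shows "bij_betw (word_act p) words words"
proof -
  have "bij_betw (seq_act p) E E"
    using group_action.inj_prop[OF group_action_seq_act p]
      group_action.surj_prop[OF group_action_seq_act p] by (simp add: bij_betw_def)
  then have "bij_betw (inv_into words encode \<circ> (seq_act p \<circ> encode)) words words"
    using bij_betw_encode bij_betw_inv_into[OF bij_betw_encode] by (intro bij_betw_trans)
  then show ?thesis
    by (rule bij_betw_cong[THEN iffD1, rotated]) (simp add: word_act_def)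
qed

text \<open>Both sides have the same image under the injective \<open>encode\<close>: it carries
  orbits to orbits in \<open>E\<close>, where the associated permutation is the inverse of the
  standardization.\<close>

lemma Orb_eq:
  assumes w: "w \<in> words"
  shows "Orb w = {w' \<in> words. Std w' = Std w}"
proof -
  have "encode ` Orb w = {seq_act p (encode w) |p. p \<in> carrier S_inf}"
    using word_act_closed(2)[OF w] by (force simp: Orb_def orbit_def)
  also have "\<dots> = {b \<in> encode ` words. assoc_perm b = assoc_perm (encode w)}"
    using orbit_seq_act[OF encode_in_E[OF w]] bij_betw_encode by (simp add: bij_betw_def)
  also have "\<dots> = encode ` {w' \<in> words. Std w' = Std w}"
    using w by (auto simp: assoc_perm_encode Std_eq_iff_inverse)
  finally have "encode ` Orb w = encode ` {w' \<in> words. Std w' = Std w}" .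
  moreover have "Orb w \<subseteq> words"
    using word_act_closed(1)[OF w] by (auto simp: Orb_def orbit_def)
  ultimately show ?thesis
    by (subst (asm) inj_on_image_eq_iff[OF inj_on_encode]) auto
qed

text \<open>Each orbit contains the standardization of its members, so constancy on orbits can be
  tested against that one representative.\<close>

lemma fqs_invariant_iff:
  fixes x :: "nat list \<Rightarrow> 'k::field_char_0"
  assumes x: "x \<in> formal_sums"
  shows "fqs_invariant x \<longleftrightarrow> (\<forall>w\<in>words. x (Std w) = x w)"
proof -
  have act: "formal_act p x (word_act p w) = x w" if "p \<in> carrier S_inf" "w \<in> words" for p w
  proof -
    \<comment> \<open>Injectivity on words leaves a single summand in
      \<open>formal_act\<close>.\<close>
    have "{v \<in> words. word_act p v = word_act p w} = {w}"
      using bij_betw_word_act[OF that(1)] that(2) by (auto simp: bij_betw_def inj_on_def)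
    then show ?thesis by (simp add: formal_act_def)
  qed
  have out: "formal_act p x v = x v" if "p \<in> carrier S_inf" "v \<notin> words" for p v
  proof -
    have "{w \<in> words. word_act p w = v} = {}"
      using word_act_closed(1) that by blast
    then show ?thesis
      using x that unfolding formal_act_def formal_sums_def by (simp only: sum.empty) simp
  qed
  have "fqs_invariant x \<longleftrightarrow> (\<forall>p\<in>carrier S_inf. \<forall>v\<in>words. formal_act p x v = x v)"
    using out by (fastforce simp: fqs_invariant_def)
  \<comment> \<open>Surjectivity on words allows \<open>v\<close> to be replaced by
    \<open>word_act p w\<close>.\<close>
  also have "\<dots> \<longleftrightarrow> (\<forall>p\<in>carrier S_inf. \<forall>w\<in>words. x (word_act p w) = x w)"
  proof (rule ball_cong[OF refl])
    fix p assume p: "p \<in> carrier S_inf"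
    then have "word_act p ` words = words"
      using bij_betw_word_act by (simp add: bij_betw_def)
    then have "(\<forall>v\<in>words. formal_act p x v = x v) \<longleftrightarrow>
        (\<forall>w\<in>words. formal_act p x (word_act p w) = x (word_act p w))"
      by (metis (no_types, lifting) image_iff)
    then show "(\<forall>v\<in>words. formal_act p x v = x v) \<longleftrightarrow> (\<forall>w\<in>words. x (word_act p w) = x w)"
      using act[OF p] by auto
  qed
  also have "\<dots> \<longleftrightarrow> (\<forall>w\<in>words. \<forall>w'\<in>Orb w. x w' = x w)"
    by (auto simp: Orb_def orbit_def)
  also have "\<dots> \<longleftrightarrow> (\<forall>w\<in>words. \<forall>w'\<in>words. Std w' = Std w \<longrightarrow> x w' = x w)"
    using Orb_eq by auto
  also have "\<dots> \<longleftrightarrow> (\<forall>w\<in>words. x (Std w) = x w)" (is "?L = ?R")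
  proof
    show ?R if ?L
      using that Std_in_perms Std_perm perms_subset_words by blast
    show ?L if ?R
    proof (intro ballI impI)
      fix w w' assume "w \<in> words" "w' \<in> words" "Std w' = Std w"
      then show "x w' = x w"
        using bspec[OF that, of w] bspec[OF that, of w'] by simp
    qed
  qed
  finally show ?thesis .
qed

section \<open>The span of the \<open>G \<sigma>\<close> and its completion\<close>

lemma G_apply: "(G \<sigma> :: nat list \<Rightarrow> 'k::field_char_0) w = (if w \<in> words \<and> Std w = \<sigma> then 1 else 0)"
  by (simp add: G_def indicator_def)

text \<open>The condition is linear in \<open>x\<close>, and every \<open>G \<sigma>\<close>
  satisfies it because \<open>Std\<close> is idempotent.\<close>

lemma FQSym_dual_Std:
  fixes x :: "nat list \<Rightarrow> 'k::field_char_0"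
  assumes "x \<in> FQSym_dual" "w \<in> words"
  shows "x (Std w) = x w"
  using assms(1) unfolding FQSym_dual_def
proof (induction rule: formal.span_induct_alt)
  case base
  then show ?case by simp
next
  case (step c y z)
  have "Std w \<in> words" "Std (Std w) = Std w"
    using Std_in_perms Std_perm perms_subset_words by blast+
  with step assms(2) show ?case
    by (auto simp: scale_formal_def G_apply)
qed

lemma FQSym_dualI:
  fixes x :: "nat list \<Rightarrow> 'k::field_char_0"
  assumes x: "x \<in> formal_sums" and bdd: "bounded_degree x"
    and Std: "\<And>w. w \<in> words \<Longrightarrow> x (Std w) = x w"
  shows "x \<in> FQSym_dual"
proof -
  obtain d where d: "\<And>w. x w \<noteq> 0 \<Longrightarrow> length w \<le> d"
    using bdd by (auto simp: bounded_degree_def)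
  \<comment> \<open>The permutations up to the degree bound are finitely many, as a linear span
    demands.\<close>
  define S where "S = (\<Union>n\<le>d. perms n)"
  have fin: "finite S" by (simp add: S_def)
  have "x w = (\<Sum>\<sigma>\<in>S. scale_formal (x \<sigma>) (G \<sigma>)) w" for w
  proof -
    have "(\<Sum>\<sigma>\<in>S. scale_formal (x \<sigma>) (G \<sigma>)) w = (\<Sum>\<sigma>\<in>S. x \<sigma> * G \<sigma> w)"
      using fin by (induction S rule: finite_induct) (auto simp: scale_formal_def)
    also have "\<dots> = x w"
    proof (cases "w \<in> words")
      case True
      then have "(\<Sum>\<sigma>\<in>S. x \<sigma> * G \<sigma> w) = (\<Sum>\<sigma>\<in>S. if Std w = \<sigma> then x \<sigma> else 0)"
        by (intro sum.cong) (auto simp: G_apply)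
      also have "\<dots> = (if Std w \<in> S then x w else 0)"
        using fin Std[OF True] by (simp add: sum.delta)
      \<comment> \<open>If \<open>Std w\<close> is outside \<open>S\<close>, then \<open>w\<close>
        is longer than \<open>d\<close> and its coefficient vanishes.\<close>
      also have "\<dots> = x w"
        using d[of w] Std_in_perms[of w] by (auto simp: S_def)
      finally show ?thesis .
    next
      case False
      then show ?thesis using x by (simp add: G_apply formal_sums_def)
    qed
    finally show ?thesis by simp
  qed
  then have "x = (\<Sum>\<sigma>\<in>S. scale_formal (x \<sigma>) (G \<sigma>))" by (rule ext)
  also have "\<dots> \<in> FQSym_dual"
    unfolding FQSym_dual_def
    by (intro formal.span_sum formal.span_scale formal.span_base imageI)
      (auto simp: S_def perm_words_def)
  finally show ?thesis .
qed

lemma FQSym_dual_iff: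
  assumes "x \<in> formal_sums" "bounded_degree x"
  shows "x \<in> FQSym_dual \<longleftrightarrow> (\<forall>w\<in>words. x (Std w) = x w)"
  using FQSym_dualI[OF assms] FQSym_dual_Std by blast

text \<open>\<open>Std\<close> preserves length, so the criterion can be checked on the homogeneous
  parts, each of which has bounded degree.\<close>

lemma FQSym_dual_completion_iff:
  assumes x: "x \<in> formal_sums"
  shows "x \<in> FQSym_dual_completion \<longleftrightarrow> (\<forall>w\<in>words. x (Std w) = x w)"
proof -
  have "homogeneous_part n x \<in> formal_sums" "bounded_degree (homogeneous_part n x)" for n
    using x by (auto simp: formal_sums_def homogeneous_part_def bounded_degree_def)
  then have "x \<in> FQSym_dual_completion \<longleftrightarrow>
      (\<forall>n. \<forall>w\<in>words. homogeneous_part n x (Std w) = homogeneous_part n x w)"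
    by (simp add: FQSym_dual_completion_def FQSym_dual_iff)
  then show ?thesis by (auto simp: homogeneous_part_def)
qed

theorem mainTheorem1:
  shows "(\<forall>w\<in>words. Orb w = {w' \<in> words. Std w' = Std w})
    \<and> (\<forall>\<sigma>\<in>perm_words. (G \<sigma> :: nat list \<Rightarrow> 'k::field_char_0) = sum_of_words (Orb \<sigma>))
    \<and> (\<forall>x :: nat list \<Rightarrow> 'k. x \<in> formal_sums \<and> bounded_degree x \<longrightarrow>
         (x \<in> FQSym_dual \<longleftrightarrow> fqs_invariant x))
    \<and> (\<forall>x :: nat list \<Rightarrow> 'k. x \<in> formal_sums \<longrightarrow>
         (x \<in> FQSym_dual_completion \<longleftrightarrow> fqs_invariant x))"
proof -
  have "(G \<sigma> :: nat list \<Rightarrow> 'k) = sum_of_words (Orb \<sigma>)" if "\<sigma> \<in> perm_words" for \<sigma>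
  proof -
    have "\<sigma> \<in> perms (length \<sigma>)"
      using that by (simp only: perm_words_iff)
    then have "\<sigma> \<in> words" "Std \<sigma> = \<sigma>"
      using perms_subset_words Std_perm by blast+
    then show ?thesis by (simp add: G_def Orb_eq)
  qed
  \<comment> \<open>Membership and invariance both reduce to the condition
    \<open>x (Std w) = x w\<close> on words.\<close>
  then show ?thesis
    using Orb_eq by (auto simp: FQSym_dual_iff FQSym_dual_completion_iff fqs_invariant_iff)
qed

end
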